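(* Let $V,V'$ be Lie superalgebras over a field $K$ and let $\phi:V\to V'$ be an anti-homomorphism of Lie superalgebras. If $A=(\lambda_A,\rho_A)$ is an anti-CIF Lie sub-superalgebra (respectively an anti-CIF ideal) of $V'$, then the CIF set $\phi^{-1}(A)$ of $V$ is also an anti-CIF Lie sub-superalgebra (respectively an anti-CIF ideal) of $V$.
   Context: Complex numbers in the closed unit disk are written $\alpha e^{i2\pi\beta}$ with $\alpha,\beta\in[0,1]$ and are handled through the pair $(\alpha,\beta)$: $\alpha e^{i2\pi\beta}\le\gamma e^{i2\pi\delta}$ means $\alpha\le\gamma$ and $\beta\le\delta$. The symbols $\wedge$ (min), $\vee$ (max), $\sup$, $\inf$ are taken componentwise on such pairs. The value $1$ stands for $1e^{i2\pi\cdot 1}$ and $0$ for $0e^{i2\pi\cdot 0}$. A complex intuitionistic fuzzy (CIF) set on a nonempty set $X$ is a pair $A=(\lambda_A,\rho_A)$ of functions $\lambda_A(x)=r_A(x)e^{i2\pi\omega_A(x)}$, $\rho_A(x)=\hat r_A(x)e^{i2\pi\hat\omega_A(x)}$ with $r_A,\omega_A,\hat r_A,\hat\omega_A:X\to[0,1]$ and $r_A(x)+\hat r_A(x)\le 1$ for all $x$. A CIF set $A$ on a $K$-vector space $V$ is a CIF vector subspace of $V$ if for all $x,y\in V$, $\alpha\in K$: $\lambda_A(x+y)\ge\lambda_A(x)\wedge\lambda_A(y)$, $\rho_A(x+y)\le\rho_A(x)\vee\rho_A(y)$, $\lambda_A(\alpha x)\ge\lambda_A(x)$, $\rho_A(\alpha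 x)\le\rho_A(x)$; moreover it is always assumed that $\lambda_A(0)=1$ and $\rho_A(0)=0$. A Lie superalgebra over $K$ is a $\mathbb{Z}_2$-graded vector space $V=V_0+V_1$ (direct sum) with a bilinear bracket $[\,,]:V\times V\to V$ such that $[V_i,V_j]\subseteq V_{i+j}$; $[x,y]=-(-1)^{|x||y|}[y,x]$; and $[x,[y,z]]-(-1)^{|x||y|}[y,[x,z]]=[[x,y],z]$ for homogeneous elements. Given CIF vector subspaces $A_j$ of $V_j$ ($j=0,1$), let $\mathfrak a_j$ be the extension of $A_j$ to $V$: $\lambda_{\mathfrak a_j}=\lambda_{A_j}$, $\rho_{\mathfrak a_j}=\rho_{A_j}$ on $V_j$, and $\lambda_{\mathfrak a_j}=0$, $\rho_{\mathfrak a_j}=1$ off $V_j$. Then $A_0\oplus A_1$ denotes the CIF set $\mathfrak a_0+\mathfrak a_1$ on $V$ given by $\lambda(x)=\sup_{x=a+b}\{\lambda_{\mathfrak a_0}(a)\wedge\lambda_{\mathfrak a_1}(b)\}$, $\rho(x)=\inf_{x=a+b}\{\rho_{\mathfrak a_0}(a)\vee\rho_{\mathfrak a_1}(b)\}$. A CIF vector subspace $A$ of $V$ is $\mathbb{Z}_2$-graded if $A=A_0\oplus A_1$ for some such $A_0,A_1$. A CIF set $A$ of $V$ is an anti-CIF Lie sub-superalgebra of $V$ if it is a $\mathbb{Z}_2$-graded CIF vector subspace of $V$ and $\lambda_A(-[x,y])\ge\lambda_A(x)\wedge\lambda_A(y)$, $\rho_A(-[x,y])\le\rho_A(x)\vee\rho_A(y)$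 for all $x,y\in V$. It is an anti-CIF ideal of $V$ if it is a $\mathbb{Z}_2$-graded CIF vector subspace of $V$ and $\lambda_A(-[x,y])\ge\lambda_A(x)\vee\lambda_A(y)$, $\rho_A(-[x,y])\le\rho_A(x)\wedge\rho_A(y)$ for all $x,y\in V$. An anti-homomorphism of Lie superalgebras $\phi:V\to V'$ is a linear map with $\phi(V_\alpha)\subseteq V'_\alpha$ for $\alpha=0,1$ and $\phi([x,y])=-[\phi(x),\phi(y)]$ for all $x,y\in V$. The preimage $\phi^{-1}(A)$ of a CIF set $A$ of $V'$ is the CIF set of $V$ with $\lambda_{\phi^{-1}(A)}(x)=\lambda_A(\phi(x))$ and $\rho_{\phi^{-1}(A)}(x)=\rho_A(\phi(x))$. *)

theory Defs
  imports Complex_Main "HOL-Library.Z2" "HOL-Library.Product_Order"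
begin

section \<open>Lie superalgebras\<close>

text \<open>
  The carrier is the whole type \<open>'v\<close>. The grading is indexed by the two-element ring \<open>bit\<close>, so
  that \<open>i + j\<close> and \<open>i * j\<close> are computed in $Z/2$; \<open>of_bit\<close> lifts the exponent to \<open>{0, 1}\<close>.
\<close>

locale lie_superalgebra = vector_space scale
  for scale :: "'k::field \<Rightarrow> 'v::ab_group_add \<Rightarrow> 'v" +
  fixes V :: "bit \<Rightarrow> 'v set"
    and bracket :: "'v \<Rightarrow> 'v \<Rightarrow> 'v"
  assumes grade_subspace: "subspace (V i)"
    and grade_inter: "V 0 \<inter> V 1 = {0}"
    and grade_sum: "{a + b | a b. a \<in> V 0 \<and> b \<in> V 1} = UNIV"
    and bracket_linear_left: "Vector_Spaces.linear scale scale (\<lambda>x. bracket x y)"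
    and bracket_linear_right: "Vector_Spaces.linear scale scale (\<lambda>y. bracket x y)"
    and bracket_grade: "x \<in> V i \<Longrightarrow> y \<in> V j \<Longrightarrow> bracket x y \<in> V (i + j)"
    and bracket_antisym: "x \<in> V i \<Longrightarrow> y \<in> V j \<Longrightarrow>
      bracket x y = - scale ((- 1) ^ of_bit (i * j)) (bracket y x)"
    and bracket_jacobi: "x \<in> V i \<Longrightarrow> y \<in> V j \<Longrightarrow> z \<in> V l \<Longrightarrow>
      bracket x (bracket y z) - scale ((- 1) ^ of_bit (i * j)) (bracket y (bracket x z))
        = bracket (bracket x y) z"

definition lie_super_anti_hom ::
  "('k::field \<Rightarrow> 'v::ab_group_add \<Rightarrow> 'v) \<Rightarrow> (bit \<Rightarrow> 'v set) \<Rightarrow> ('v \<Rightarrow> 'v \<Rightarrow> 'v) \<Rightarrow>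
   ('k \<Rightarrow> 'w::ab_group_add \<Rightarrow> 'w) \<Rightarrow> (bit \<Rightarrow> 'w set) \<Rightarrow> ('w \<Rightarrow> 'w \<Rightarrow> 'w) \<Rightarrow> ('v \<Rightarrow> 'w) \<Rightarrow> bool"
where
  "lie_super_anti_hom scale V bracket scale' V' bracket' \<phi> \<longleftrightarrow>
     Vector_Spaces.linear scale scale' \<phi> \<and>
     (\<forall>i. \<phi> ` V i \<subseteq> V' i) \<and>
     (\<forall>x y. \<phi> (bracket x y) = - bracket' (\<phi> x) (\<phi> y))"


section \<open>Complex intuitionistic fuzzy sets\<close>

text \<open>
  The value $\alpha e^{i 2 \pi \beta}$ is represented by the pair \<open>(\<alpha>, \<beta>)\<close>: the order and the
  lattice operations depend on the pair and not on the complex number it denotes (which does not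
  distinguish \<open>\<beta> = 0\<close> from \<open>\<beta> = 1\<close>). The order, \<open>inf\<close>, \<open>sup\<close>, \<open>Inf\<close> and \<open>Sup\<close> on pairs are the
  componentwise ones of \<open>Product_Order\<close>.
\<close>

type_synonym cval = "real \<times> real"

abbreviation cval_one :: cval where "cval_one \<equiv> (1, 1)"

abbreviation cval_zero :: cval where "cval_zero \<equiv> (0, 0)"

datatype 'a cif = CIF (mem: "'a \<Rightarrow> cval") (nonmem: "'a \<Rightarrow> cval")

text \<open>The two functions of a CIF set on \<open>X\<close> are unconstrained, and irrelevant, outside \<open>X\<close>.\<close>

definition cif_set :: "'a set \<Rightarrow> 'a cif \<Rightarrow> bool" where
  "cif_set X A \<longleftrightarrow>
     (\<forall>x\<in>X. mem A x \<in> {0..1} \<times> {0..1} \<and> nonmem A x \<in> {0..1} \<times> {0..1} \<and>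
            fst (mem A x) + fst (nonmem A x) \<le> 1)"

text \<open>CIF vector subspace of the vector space carried by the linear subspace \<open>W\<close>.\<close>

definition cif_subspace ::
  "('k::field \<Rightarrow> 'v::ab_group_add \<Rightarrow> 'v) \<Rightarrow> 'v set \<Rightarrow> 'v cif \<Rightarrow> bool" where
  "cif_subspace scale W A \<longleftrightarrow>
     cif_set W A \<and>
     (\<forall>x\<in>W. \<forall>y\<in>W. mem A (x + y) \<ge> inf (mem A x) (mem A y) \<and>
                    nonmem A (x + y) \<le> sup (nonmem A x) (nonmem A y)) \<and>
     (\<forall>\<alpha>. \<forall>x\<in>W. mem A (scale \<alpha> x) \<ge> mem A x \<and> nonmem A (scale \<alpha> x) \<le> nonmem A x) \<and>
     mem A 0 = cval_one \<and> nonmem A 0 = cval_zero"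

definition cif_extend :: "'a set \<Rightarrow> 'a cif \<Rightarrow> 'a cif" where
  "cif_extend W A =
     CIF (\<lambda>x. if x \<in> W then mem A x else cval_zero)
         (\<lambda>x. if x \<in> W then nonmem A x else cval_one)"

definition cif_plus :: "'v::ab_group_add cif \<Rightarrow> 'v cif \<Rightarrow> 'v cif" where
  "cif_plus A B =
     CIF (\<lambda>x. SUP (a, b) \<in> {(a, b). x = a + b}. inf (mem A a) (mem B b))
         (\<lambda>x. INF (a, b) \<in> {(a, b). x = a + b}. sup (nonmem A a) (nonmem B b))"

definition cif_direct_sum ::
  "(bit \<Rightarrow> 'v::ab_group_add set) \<Rightarrow> 'v cif \<Rightarrow> 'v cif \<Rightarrow> 'v cif" where
  "cif_direct_sum V A0 A1 = cif_plus (cif_extend (V 0) A0) (cif_extend (V 1) A1)"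

definition graded_cif_subspace ::
  "('k::field \<Rightarrow> 'v::ab_group_add \<Rightarrow> 'v) \<Rightarrow> (bit \<Rightarrow> 'v set) \<Rightarrow> 'v cif \<Rightarrow> bool" where
  "graded_cif_subspace scale V A \<longleftrightarrow>
     cif_subspace scale UNIV A \<and>
     (\<exists>A0 A1. cif_subspace scale (V 0) A0 \<and> cif_subspace scale (V 1) A1 \<and>
              A = cif_direct_sum V A0 A1)"

definition anti_cif_lie_sub_superalgebra ::
  "('k::field \<Rightarrow> 'v::ab_group_add \<Rightarrow> 'v) \<Rightarrow> (bit \<Rightarrow> 'v set) \<Rightarrow> ('v \<Rightarrow> 'v \<Rightarrow> 'v) \<Rightarrow> 'v cif \<Rightarrow> bool"
where
  "anti_cif_lie_sub_superalgebra scale V bracket A \<longleftrightarrow>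
     graded_cif_subspace scale V A \<and>
     (\<forall>x y. mem A (- bracket x y) \<ge> inf (mem A x) (mem A y) \<and>
            nonmem A (- bracket x y) \<le> sup (nonmem A x) (nonmem A y))"

definition anti_cif_ideal ::
  "('k::field \<Rightarrow> 'v::ab_group_add \<Rightarrow> 'v) \<Rightarrow> (bit \<Rightarrow> 'v set) \<Rightarrow> ('v \<Rightarrow> 'v \<Rightarrow> 'v) \<Rightarrow> 'v cif \<Rightarrow> bool"
where
  "anti_cif_ideal scale V bracket A \<longleftrightarrow>
     graded_cif_subspace scale V A \<and>
     (\<forall>x y. mem A (- bracket x y) \<ge> sup (mem A x) (mem A y) \<and>
            nonmem A (- bracket x y) \<le> inf (nonmem A x) (nonmem A y))"

definition cif_preimage :: "('a \<Rightarrow> 'b) \<Rightarrow> 'b cif \<Rightarrow> 'a cif" where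
  "cif_preimage \<phi> A = CIF (\<lambda>x. mem A (\<phi> x)) (\<lambda>x. nonmem A (\<phi> x))"

end

(* The decomposition of a vector into its even and odd parts is unique, and every other splitting
   a + b contributes only 0 to the supremum and only 1 to the infimum defining A0 \<oplus> A1. Hence
   A0 \<oplus> A1 takes at a + b (a even, b odd) the values inf (mem A0 a) (mem A1 b) and
   sup (nonmem A0 a) (nonmem A1 b). As an anti-homomorphism preserves the grading, this shows that
   the preimage of A0 \<oplus> A1 is the direct sum of the preimages of A0 and A1. In the bracket
   conditions the extra sign is absorbed by scaling with -1. *)
theory Submission
  imports Defs
begin

text \<open>On pairs of reals \<open>Sup\<close> is informative only for nonempty sets bounded
  above. A maximum that belongs to \<open>S\<close> secures both, and its components are maxima of
  the two projections of \<open>S\<close>.\<close>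

lemma Sup_prod_eq_maximum:
  fixes S :: "('a::conditionally_complete_lattice \<times> 'b::conditionally_complete_lattice) set"
  assumes "m \<in> S" "\<And>s. s \<in> S \<Longrightarrow> s \<le> m"
  shows "Sup S = m"
  using assms
  by (auto simp: Sup_prod_def less_eq_prod_def prod_eq_iff intro!: cSup_eq_maximum)

lemma Inf_prod_eq_minimum:
  fixes S :: "('a::conditionally_complete_lattice \<times> 'b::conditionally_complete_lattice) set"
  assumes "m \<in> S" "\<And>s. s \<in> S \<Longrightarrow> m \<le> s"
  shows "Inf S = m"
  using assms
  by (auto simp: Inf_prod_def less_eq_prod_def prod_eq_iff intro!: cInf_eq_minimum)

lemma cif_setD:
  assumes "cif_set X A" "x \<in> X"
  shows "cval_zero \<le> mem A x" "mem A x \<le> cval_one"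
    and "cval_zero \<le> nonmem A x" "nonmem A x \<le> cval_one"
  using assms by (auto simp: cif_set_def less_eq_prod_def mem_Times_iff)

lemma cif_set_extend:
  assumes "cif_set W A"
  shows "cif_set UNIV (cif_extend W A)"
  using assms by (auto simp: cif_set_def cif_extend_def)

text \<open>Kept relative to \<open>W\<close> and \<open>W'\<close> so that it serves both for the
  even and odd parts and for the whole space.\<close>

lemma cif_subspace_preimage:
  assumes "Vector_Spaces.linear scale scale' \<phi>" "\<phi> ` W \<subseteq> W'" "cif_subspace scale' W' A"
  shows "cif_subspace scale W (cif_preimage \<phi> A)"
proof -
  interpret Vector_Spaces.linear scale scale' \<phi> by fact
  have "\<phi> x \<in> W'" if "x \<in> W" for x
    using assms(2) that by blast
  then show ?thesis
    using assms(3) by (simp add: cif_subspace_def cif_set_def cif_preimage_def add scale zero)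
qed

lemma cif_subspace_uminus:
  assumes "vector_space scale" "cif_subspace scale W A" "x \<in> W"
  shows "mem A x \<le> mem A (- x)" "nonmem A (- x) \<le> nonmem A x"
proof -
  interpret vector_space scale by fact
  have "scale (- 1) x = - x"
    by simp
  then show "mem A x \<le> mem A (- x)" "nonmem A (- x) \<le> nonmem A x"
    using assms(2,3) unfolding cif_subspace_def by metis+
qed

context lie_superalgebra
begin

lemma graded_decompose:
  obtains a b where "a \<in> V 0" "b \<in> V 1" "x = a + b"
  using grade_sum by blast

text \<open>The difference of two splittings is \<open>c - a = b - d\<close>, which lies in both
  \<open>V 0\<close> and \<open>V 1\<close> and hence vanishes.\<close>

lemma graded_unique:
  assumes "a \<in> V 0" "b \<in> V 1" "c \<in> V 0" "d \<in> V 1" "a + b = c + d"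
  shows "c = a" "d = b"
proof -
  have eq: "c - a = b - d"
    using assms(5) by (simp add: algebra_simps)
  moreover have "c - a \<in> V 0" "b - d \<in> V 1"
    using assms by (auto intro: subspace_diff grade_subspace)
  ultimately have "c - a \<in> {0}"
    unfolding grade_inter[symmetric] by simp
  then show "c = a" "d = b"
    using eq by auto
qed

lemma cif_direct_sum_add:
  assumes "cif_set (V 0) A0" "cif_set (V 1) A1" and ab: "a \<in> V 0" "b \<in> V 1"
  shows "mem (cif_direct_sum V A0 A1) (a + b) = inf (mem A0 a) (mem A1 b)"
    and "nonmem (cif_direct_sum V A0 A1) (a + b) = sup (nonmem A0 a) (nonmem A1 b)"
proof -
  let ?E0 = "cif_extend (V 0) A0" and ?E1 = "cif_extend (V 1) A1"
  \<comment> \<open>Splittings range over all pairs of vectors, so the bounds are needed also off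
    \<open>V 0\<close> and \<open>V 1\<close>, where the extensions take their default
    values.\<close>
  note E0 = cif_setD[OF cif_set_extend[OF assms(1)] UNIV_I]
  note E1 = cif_setD[OF cif_set_extend[OF assms(2)] UNIV_I]
  have E_ab: "mem ?E0 a = mem A0 a" "mem ?E1 b = mem A1 b"
    "nonmem ?E0 a = nonmem A0 a" "nonmem ?E1 b = nonmem A1 b"
    using ab by (simp_all add: cif_extend_def)
  \<comment> \<open>By uniqueness, a second splitting has \<open>c\<close> outside
    \<open>V 0\<close> or \<open>d\<close> outside \<open>V 1\<close>, so one extension takes its
    default values there.\<close>
  have other: "(mem ?E0 c = cval_zero \<or> mem ?E1 d = cval_zero) \<and>
      (nonmem ?E0 c = cval_one \<or> nonmem ?E1 d = cval_one)"
    if "a + b = c + d" "\<not> (c = a \<and> d = b)" for c d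
    using that graded_unique[OF ab] by (auto simp: cif_extend_def)
  have le: "inf (mem ?E0 c) (mem ?E1 d) \<le> inf (mem ?E0 a) (mem ?E1 b)"
    "sup (nonmem ?E0 a) (nonmem ?E1 b) \<le> sup (nonmem ?E0 c) (nonmem ?E1 d)"
    if "a + b = c + d" for c d
  proof -
    have "inf (mem ?E0 c) (mem ?E1 d) \<le> inf (mem ?E0 a) (mem ?E1 b) \<and>
      sup (nonmem ?E0 a) (nonmem ?E1 b) \<le> sup (nonmem ?E0 c) (nonmem ?E1 d)"
    proof (cases "c = a \<and> d = b")
      case False
      have "inf (mem ?E0 c) (mem ?E1 d) \<le> cval_zero"
        using other[OF that False] by (metis inf.cobounded1 inf.cobounded2)
      also have "cval_zero \<le> inf (mem ?E0 a) (mem ?E1 b)"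
        by (intro le_infI E0 E1)
      finally have mem_le: "inf (mem ?E0 c) (mem ?E1 d) \<le> inf (mem ?E0 a) (mem ?E1 b)" .
      have "sup (nonmem ?E0 a) (nonmem ?E1 b) \<le> cval_one"
        by (intro le_supI E0 E1)
      also have "cval_one \<le> sup (nonmem ?E0 c) (nonmem ?E1 d)"
        using other[OF that False] by (metis sup.cobounded1 sup.cobounded2)
      finally show ?thesis
        using mem_le by blast
    qed auto
    then show "inf (mem ?E0 c) (mem ?E1 d) \<le> inf (mem ?E0 a) (mem ?E1 b)"
      "sup (nonmem ?E0 a) (nonmem ?E1 b) \<le> sup (nonmem ?E0 c) (nonmem ?E1 d)"
      by blast+
  qed
  have "mem (cif_direct_sum V A0 A1) (a + b) = inf (mem ?E0 a) (mem ?E1 b)"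
    unfolding cif_direct_sum_def cif_plus_def cif.sel
    by (rule Sup_prod_eq_maximum) (use le in auto)
  moreover have "nonmem (cif_direct_sum V A0 A1) (a + b) = sup (nonmem ?E0 a) (nonmem ?E1 b)"
    unfolding cif_direct_sum_def cif_plus_def cif.sel
    by (rule Inf_prod_eq_minimum) (use le in auto)
  ultimately show "mem (cif_direct_sum V A0 A1) (a + b) = inf (mem A0 a) (mem A1 b)"
    "nonmem (cif_direct_sum V A0 A1) (a + b) = sup (nonmem A0 a) (nonmem A1 b)"
    by (simp_all add: E_ab)
qed

end

text \<open>The bracket condition on \<open>\<phi>\<close> is left out so that this serves
  sub-superalgebras and ideals alike. If \<open>a\<close> and \<open>b\<close> are the even and odd
  parts of \<open>x\<close>, then \<open>\<phi> a\<close> and \<open>\<phi> b\<close> are those of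
  \<open>\<phi> x\<close>, so both direct sums are evaluated at matching splittings.\<close>

lemma graded_cif_subspace_preimage:
  assumes "lie_superalgebra scale V bracket" "lie_superalgebra scale' V' bracket'"
    and lin: "Vector_Spaces.linear scale scale' \<phi>"
    and grade: "\<And>i. \<phi> ` V i \<subseteq> V' i"
    and A: "graded_cif_subspace scale' V' A"
  shows "graded_cif_subspace scale V (cif_preimage \<phi> A)"
proof -
  interpret L: lie_superalgebra scale V bracket by fact
  interpret L': lie_superalgebra scale' V' bracket' by fact
  interpret Vector_Spaces.linear scale scale' \<phi> by fact
  obtain A0 A1 where A01: "cif_subspace scale' (V' 0) A0" "cif_subspace scale' (V' 1) A1"
    and A_eq: "A = cif_direct_sum V' A0 A1"
    using A by (auto simp: graded_cif_subspace_def)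
  let ?B0 = "cif_preimage \<phi> A0" and ?B1 = "cif_preimage \<phi> A1"
  have B01: "cif_subspace scale (V 0) ?B0" "cif_subspace scale (V 1) ?B1"
    using cif_subspace_preimage[OF lin grade] A01 by auto
  have "mem (cif_preimage \<phi> A) x = mem (cif_direct_sum V ?B0 ?B1) x \<and>
      nonmem (cif_preimage \<phi> A) x = nonmem (cif_direct_sum V ?B0 ?B1) x" for x
  proof -
    obtain a b where ab: "a \<in> V 0" "b \<in> V 1" and x: "x = a + b"
      by (rule L.graded_decompose)
    have ab': "\<phi> a \<in> V' 0" "\<phi> b \<in> V' 1"
      using grade ab by blast+
    have cif_sets: "cif_set (V' 0) A0" "cif_set (V' 1) A1" "cif_set (V 0) ?B0" "cif_set (V 1) ?B1"
      using A01 B01 by (simp_all add: cif_subspace_def)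
    show ?thesis
      using L'.cif_direct_sum_add[OF cif_sets(1,2) ab'] L.cif_direct_sum_add[OF cif_sets(3,4) ab]
      by (simp add: x A_eq add cif_preimage_def)
  qed
  then have "cif_preimage \<phi> A = cif_direct_sum V ?B0 ?B1"
    by (intro cif.expand conjI ext) auto
  moreover have "cif_subspace scale UNIV (cif_preimage \<phi> A)"
    using A cif_subspace_preimage[OF lin subset_UNIV] by (simp add: graded_cif_subspace_def)
  ultimately show ?thesis
    using B01 by (auto simp: graded_cif_subspace_def)
qed

theorem proposition4p3:
  fixes scale :: "'k::field \<Rightarrow> 'v::ab_group_add \<Rightarrow> 'v"
    and V :: "bit \<Rightarrow> 'v set"
    and bracket :: "'v \<Rightarrow> 'v \<Rightarrow> 'v"
    and scale' :: "'k \<Rightarrow> 'w::ab_group_add \<Rightarrow> 'w"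
    and V' :: "bit \<Rightarrow> 'w set"
    and bracket' :: "'w \<Rightarrow> 'w \<Rightarrow> 'w"
    and \<phi> :: "'v \<Rightarrow> 'w"
    and A :: "'w cif"
  assumes "lie_superalgebra scale V bracket"
    and "lie_superalgebra scale' V' bracket'"
    and "lie_super_anti_hom scale V bracket scale' V' bracket' \<phi>"
  shows "(anti_cif_lie_sub_superalgebra scale' V' bracket' A \<longrightarrow>
            anti_cif_lie_sub_superalgebra scale V bracket (cif_preimage \<phi> A)) \<and>
         (anti_cif_ideal scale' V' bracket' A \<longrightarrow>
            anti_cif_ideal scale V bracket (cif_preimage \<phi> A))"
proof -
  interpret L': lie_superalgebra scale' V' bracket' by fact
  have lin: "Vector_Spaces.linear scale scale' \<phi>"
    and grade: "\<And>i. \<phi> ` V i \<subseteq> V' i"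
    and br: "\<And>x y. \<phi> (bracket x y) = - bracket' (\<phi> x) (\<phi> y)"
    using assms(3) by (auto simp: lie_super_anti_hom_def)
  interpret Vector_Spaces.linear scale scale' \<phi> by fact
  have graded: "graded_cif_subspace scale V (cif_preimage \<phi> A)"
    if "graded_cif_subspace scale' V' A"
    by (rule graded_cif_subspace_preimage[OF assms(1,2) lin grade that])
  \<comment> \<open>The hypothesis on \<open>A\<close> bounds its values at
    \<open>- bracket' u v\<close>, but the preimage is evaluated at
    \<open>\<phi> (- bracket x y)\<close>, where the two signs cancel. Negating
    \<open>- bracket' u v\<close> passes from one to the other.\<close>
  have sign: "mem A (- bracket' u v) \<le> mem A (bracket' u v)"
    "nonmem A (bracket' u v) \<le> nonmem A (- bracket' u v)"
    if "graded_cif_subspace scale' V' A" for u v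
    using that cif_subspace_uminus[OF L'.vector_space_axioms, of UNIV A "- bracket' u v"]
    by (simp_all add: graded_cif_subspace_def)
  have pre: "mem (cif_preimage \<phi> A) x = mem A (\<phi> x)"
    "nonmem (cif_preimage \<phi> A) x = nonmem A (\<phi> x)"
    "\<phi> (- bracket x y) = bracket' (\<phi> x) (\<phi> y)" for x y
    by (simp_all add: cif_preimage_def neg br)
  show ?thesis
    \<comment> \<open>Both claims chain the hypothesis at \<open>\<phi> x\<close> and
      \<open>\<phi> y\<close> with \<open>sign\<close>; whether the bound is an \<open>inf\<close>
      or a \<open>sup\<close> makes no difference to the chaining.\<close>
    unfolding anti_cif_lie_sub_superalgebra_def anti_cif_ideal_def pre
    using graded by (blast intro: order.trans[OF _ sign(1)] order.trans[OF sign(2)])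
qed

end
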